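(* Let $n, p, q$ be integers with $n \ge 5$ and $1 \le p < q < \frac{n}{2}$. The graph $\mathrm{Circ}(n, \{p, q\})$ is singular if and only if $v_2(p + q) < v_2(n)$ or $v_2(q - p) < v_2(n)$.
   Context: For an integer $n \ge 1$ and a set $S$ of integers $j$ with $1 \le j \le \frac{n}{2}$, $\mathrm{Circ}(n, S)$ denotes the circulant graph with vertex set $\{0, 1, \ldots, n-1\}$ in which two distinct vertices $i, k$ are adjacent if and only if $i - k \equiv s$ or $i - k \equiv -s \pmod n$ for some $s \in S$. A graph is singular if its nullity (the dimension of the null space of its adjacency matrix) is positive. For a positive integer $x$, $v_2(x)$ is the exponent of the prime $2$ in the factorization of $x$. *)

theory Defs
  imports
    "HOL-Computational_Algebra.Primes"
    "HOL-Number_Theory.Cong"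
    "Graph_Theory.Pair_Digraph"
    "Jordan_Normal_Form.Matrix_Kernel"
begin

text \<open>Simple graphs are symmetric loop-free digraphs (locale \<^locale>\<open>pair_graph\<close>); the edge
  between \<open>i\<close> and \<open>k\<close> is represented by the two arcs \<open>(i, k)\<close> and \<open>(k, i)\<close>.\<close>

text \<open>Intended for \<open>n \<ge> 1\<close> and \<open>S\<close> a set of integers \<open>j\<close> with \<open>1 \<le> j \<le> n/2\<close>.\<close>

definition Circ :: "int \<Rightarrow> int set \<Rightarrow> int pair_pre_digraph" where
  "Circ n S = \<lparr> pverts = {0..<n},
     parcs = {(i, k). i \<in> {0..<n} \<and> k \<in> {0..<n} \<and> i \<noteq> k \<and>
                (\<exists>s\<in>S. [i - k = s] (mod n) \<or> [i - k = - s] (mod n))} \<rparr>"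

lemma pair_graph_Circ: "pair_graph (Circ n S)"
proof -
  have cong_swap: "[k - i = s] (mod n) \<longleftrightarrow> [i - k = - s] (mod n)" for i k s
    using cong_minus_minus_iff[of "i - k" "- s" n] by simp
  have "sym (parcs (Circ n S))"
  proof (rule symI)
    fix i k assume "(i, k) \<in> parcs (Circ n S)"
    then obtain s where s: "i \<in> {0..<n}" "k \<in> {0..<n}" "i \<noteq> k" "s \<in> S"
      and "[i - k = s] (mod n) \<or> [i - k = - s] (mod n)"
      unfolding Circ_def by auto
    then have "[k - i = s] (mod n) \<or> [k - i = - s] (mod n)"
      using cong_swap[of k i s] cong_swap[of i k s] by blast
    with s show "(k, i) \<in> parcs (Circ n S)"
      unfolding Circ_def by auto
  qed
  moreover have "finite (parcs (Circ n S))"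
    by (rule finite_subset[of _ "{0..<n} \<times> {0..<n}"]) (auto simp: Circ_def)
  moreover have "finite (pverts (Circ n S))"
    by (simp add: Circ_def)
  moreover have "fst e \<in> pverts (Circ n S) \<and> snd e \<in> pverts (Circ n S) \<and> fst e \<noteq> snd e"
    if "e \<in> parcs (Circ n S)" for e
    using that by (cases e) (simp add: Circ_def)
  ultimately show ?thesis
    by unfold_locales (simp_all add: symmetric_def)
qed

text \<open>Rows and columns are indexed by the vertices in increasing order.\<close>

definition adjacency_matrix :: "'a::linorder pair_pre_digraph \<Rightarrow> real mat" where
  "adjacency_matrix G =
     (let vs = sorted_list_of_set (pverts G)
      in mat (length vs) (length vs) (\<lambda>(i, j). if (vs ! i, vs ! j) \<in> parcs G then 1 else 0))"

definition nullity :: "'a::linorder pair_pre_digraph \<Rightarrow> nat" where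
  "nullity G = kernel_dim (adjacency_matrix G)"

definition singular_graph :: "'a::linorder pair_pre_digraph \<Rightarrow> bool" where
  "singular_graph G \<longleftrightarrow> nullity G > 0"

end

theory Submission
  imports Defs "HOL-Library.Periodic_Fun"
begin

text \<open>A kernel vector of the adjacency matrix is an \<open>n\<close>-periodic function \<open>f\<close> on the integers with
  \<open>f (x + p) + f (x - p) + f (x + q) + f (x - q) = 0\<close>. In terms of the shift \<open>T\<close>, the operator
  \<open>T\<^sup>p + T\<^sup>-\<^sup>p + T\<^sup>q + T\<^sup>-\<^sup>q\<close> factors as \<open>T\<^sup>-\<^sup>q (T\<^sup>p\<^sup>+\<^sup>q + 1) (T\<^sup>q\<^sup>-\<^sup>p + 1)\<close>, and the kernel of \<open>T\<^sup>a + 1\<close> on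
  \<open>n\<close>-periodic functions is nontrivial iff the 2-adic valuation of \<open>a\<close> is smaller than that of \<open>n\<close>:
  if \<open>n = 2\<^sup>t m\<close> with \<open>m\<close> odd and \<open>2\<^sup>t\<close> divides \<open>a\<close>, then \<open>n\<close> divides \<open>m a\<close>, so that
  \<open>T\<^sup>a f = - f\<close> forces \<open>f = T\<^sup>m\<^sup>a f = - f\<close>.\<close>

section \<open>Singularity in terms of functions on the vertices\<close>

text \<open>The kernel has a finite basis \<open>B\<close> with
  \<open>kernel_dim A = card B\<close>. Members of \<open>B\<close> are nonzero by linear
  independence, and an empty \<open>B\<close> would span only the zero vector.\<close>

lemma kernel_dim_pos_iff:
  fixes A :: "'a::field mat"
  assumes A: "A \<in> carrier_mat nr nc"
  shows "kernel_dim A > 0 \<longleftrightarrow> (\<exists>v\<in>mat_kernel A. v \<noteq> 0\<^sub>v nc)"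
proof -
  interpret kernel nr nc A
    by (rule kernel.intro) (rule A)
  obtain B where fin: "finite B" and B: "basis B"
    using kernel_basis_exists[OF A] by blast
  have dim: "kernel_dim A = card B"
    using Ker.dim_basis[OF fin B] by simp
  have indep: "lin_indpt B" and gen: "span B = mat_kernel A" and sub: "B \<subseteq> mat_kernel A"
    using B by (auto simp: Ker.basis_def)
  show ?thesis
  proof
    assume "kernel_dim A > 0"
    then obtain v where "v \<in> B"
      using dim by fastforce
    moreover have "0\<^sub>v nc \<notin> B"
      using Ker.zero_nin_lin_indpt[OF sub indep]
      by (metis (full_types) UNIV_I singletonD zero_neq_one)
    ultimately show "\<exists>v\<in>mat_kernel A. v \<noteq> 0\<^sub>v nc"
      using sub by (intro bexI[of _ v]) auto
  next
    assume v: "\<exists>v\<in>mat_kernel A. v \<noteq> 0\<^sub>v nc"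
    have "B \<noteq> {}"
    proof
      assume "B = {}"
      then have "mat_kernel A = {0\<^sub>v nc}"
        using gen Ker.span_empty by simp
      then show False
        using v by blast
    qed
    then show "kernel_dim A > 0"
      using dim fin by (simp add: card_gt_0_iff)
  qed
qed

text \<open>Indexing by the sorted vertex list is a bijection from positions to vertices, so vectors
  can be traded for functions on vertices. A row of the matrix then sums such a function over the
  neighbours of one vertex.\<close>

lemma singular_graph_iff:
  fixes G :: "'a::linorder pair_pre_digraph"
  assumes fin: "finite (pverts G)"
  shows "singular_graph G \<longleftrightarrow>
    (\<exists>f::'a \<Rightarrow> real. (\<exists>i\<in>pverts G. f i \<noteq> 0) \<and>
       (\<forall>i\<in>pverts G. (\<Sum>k\<in>{k\<in>pverts G. (i, k) \<in> parcs G}. f k) = 0))"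
proof -
  define vs where "vs = sorted_list_of_set (pverts G)"
  define N where "N = length vs"
  have bij: "bij_betw ((!) vs) {..<N} (pverts G)"
    by (rule bij_betw_nth) (simp_all add: vs_def N_def fin)
  define A where "A = adjacency_matrix G"
  have A_eq: "A = mat N N (\<lambda>(i, j). if (vs ! i, vs ! j) \<in> parcs G then 1 else 0)"
    by (simp add: A_def adjacency_matrix_def N_def vs_def Let_def)
  have A: "A \<in> carrier_mat N N"
    by (simp add: A_eq)
  have row: "(A *\<^sub>v vec N (\<lambda>j. f (vs ! j))) $ i
      = (\<Sum>k\<in>{k\<in>pverts G. (vs ! i, k) \<in> parcs G}. f k)" if i: "i < N" for f :: "'a \<Rightarrow> real" and i
  proof -
    have "(A *\<^sub>v vec N (\<lambda>j. f (vs ! j))) $ i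
        = (\<Sum>j<N. if (vs ! i, vs ! j) \<in> parcs G then f (vs ! j) else 0)"
      using i by (auto simp: A_eq scalar_prod_def lessThan_atLeast0 intro!: sum.cong)
    also have "\<dots> = (\<Sum>k\<in>pverts G. if (vs ! i, k) \<in> parcs G then f k else 0)"
      by (rule sum.reindex_bij_betw[OF bij])
    finally show ?thesis
      using fin by (simp add: sum.inter_filter)
  qed
  have pverts: "pverts G = (!) vs ` {..<N}"
    using bij by (simp add: bij_betw_def)
  have ball_pverts: "(\<forall>i\<in>pverts G. P i) \<longleftrightarrow> (\<forall>i<N. P (vs ! i))" for P
    unfolding pverts by auto
  have kernel: "vec N (\<lambda>j. f (vs ! j)) \<in> mat_kernel A \<longleftrightarrow>
      (\<forall>i\<in>pverts G. (\<Sum>k\<in>{k\<in>pverts G. (i, k) \<in> parcs G}. f k) = 0)" for f :: "'a \<Rightarrow> real"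
  proof -
    have "vec N (\<lambda>j. f (vs ! j)) \<in> mat_kernel A \<longleftrightarrow>
        (\<forall>i<N. (A *\<^sub>v vec N (\<lambda>j. f (vs ! j))) $ i = 0)"
      using A by (simp add: mat_kernel[OF A] vec_eq_iff)
    also have "\<dots> \<longleftrightarrow> (\<forall>i<N. (\<Sum>k\<in>{k\<in>pverts G. (vs ! i, k) \<in> parcs G}. f k) = 0)"
      using row by simp
    also have "\<dots> \<longleftrightarrow> (\<forall>i\<in>pverts G. (\<Sum>k\<in>{k\<in>pverts G. (i, k) \<in> parcs G}. f k) = 0)"
      by (rule ball_pverts[symmetric])
    finally show ?thesis .
  qed
  have nonzero: "vec N (\<lambda>j. f (vs ! j)) \<noteq> 0\<^sub>v N \<longleftrightarrow> (\<exists>i\<in>pverts G. f i \<noteq> 0)" for f :: "'a \<Rightarrow> real"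
    unfolding vec_eq_iff pverts by auto
  \<comment> \<open>The function looks up the position of a vertex in \<open>vs\<close>; what it
    does off the vertex set does not affect the vector.\<close>
  have repr: "\<exists>f. v = vec N (\<lambda>j. f (vs ! j))" if "v \<in> mat_kernel A" for v :: "real vec"
  proof (rule exI[of _ "\<lambda>x. v $ inv_into {..<N} ((!) vs) x"])
    show "v = vec N (\<lambda>j. v $ inv_into {..<N} ((!) vs) (vs ! j))"
    proof (rule eq_vecI)
      fix i
      assume "i < dim_vec (vec N (\<lambda>j. v $ inv_into {..<N} ((!) vs) (vs ! j)))"
      then show "v $ i = vec N (\<lambda>j. v $ inv_into {..<N} ((!) vs) (vs ! j)) $ i"
        using bij_betw_inv_into_left[OF bij, of i] by simp
    qed (use that mat_kernelD(1)[OF A] in auto)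
  qed
  have "singular_graph G \<longleftrightarrow> (\<exists>v\<in>mat_kernel A. v \<noteq> 0\<^sub>v N)"
    by (simp add: singular_graph_def nullity_def kernel_dim_pos_iff[OF A] flip: A_def)
  also have "\<dots> \<longleftrightarrow> (\<exists>f. vec N (\<lambda>j. f (vs ! j)) \<in> mat_kernel A \<and> vec N (\<lambda>j. f (vs ! j)) \<noteq> 0\<^sub>v N)"
    using repr by metis
  finally show ?thesis
    unfolding kernel nonzero by blast
qed

section \<open>From the circulant graph to periodic functions on the integers\<close>

text \<open>Any two of the offsets \<open>0\<close>, \<open>p\<close>, \<open>- p\<close>,
  \<open>q\<close>, \<open>- q\<close> differ by at most \<open>2 * q < n\<close>, so they are
  distinct modulo \<open>n\<close>. Hence \<open>i\<close> is not its own neighbour, and the four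
  neighbours do not collapse to fewer terms.\<close>

lemma Circ_pair_neighbours_sum:
  fixes n p q i :: int and f :: "int \<Rightarrow> real"
  assumes "1 \<le> p" "p < q" "2 * q < n" and i: "i \<in> {0..<n}"
  shows "(\<Sum>k\<in>{k\<in>pverts (Circ n {p, q}). (i, k) \<in> parcs (Circ n {p, q})}. f k)
    = f ((i + p) mod n) + f ((i - p) mod n) + f ((i + q) mod n) + f ((i - q) mod n)"
proof -
  have cong_iff: "[i - k = s] (mod n) \<longleftrightarrow> k = (i - s) mod n" if "k \<in> {0..<n}" for k s
  proof -
    have "[i - k = s] (mod n) \<longleftrightarrow> [k = i - s] (mod n)"
      by (simp add: cong_iff_dvd_diff dvd_diff_commute[of n _ "i - s"] algebra_simps)
        (smt (verit) dvd_minus_iff)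
    also have "\<dots> \<longleftrightarrow> k = (i - s) mod n"
      using that by (simp add: cong_def)
    finally show ?thesis .
  qed
  have distinct: "(i + a) mod n \<noteq> (i + b) mod n" if "a \<noteq> b" "\<bar>a - b\<bar> < n" for a b
  proof
    assume "(i + a) mod n = (i + b) mod n"
    then have "n dvd a - b"
      by (simp add: mod_eq_dvd_iff)
    then show False
      using that dvd_imp_le_int[of "a - b" n] by auto
  qed
  have "{k\<in>pverts (Circ n {p, q}). (i, k) \<in> parcs (Circ n {p, q})}
      = {(i + p) mod n, (i + - p) mod n, (i + q) mod n, (i + - q) mod n}" (is "?L = ?R")
  proof (rule Set.set_eqI)
    fix k
    show "k \<in> ?L \<longleftrightarrow> k \<in> ?R"
    proof (cases "k \<in> {0..<n}")
      case True
      have "i \<noteq> (i + p) mod n" "i \<noteq> (i - p) mod n" "i \<noteq> (i + q) mod n" "i \<noteq> (i - q) mod n"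
        using distinct[of 0 p] distinct[of 0 "- p"] distinct[of 0 q] distinct[of 0 "- q"] assms
        by auto
      then show ?thesis
        using True i cong_iff[OF True] by (auto simp: Circ_def)
    next
      case False
      then show ?thesis
        using assms by (auto simp: Circ_def)
    qed
  qed
  then show ?thesis
    using distinct[of p "- p"] distinct[of p q] distinct[of p "- q"] distinct[of "- p" q]
      distinct[of "- p" "- q"] distinct[of q "- q"] assms by simp
qed

lemma singular_Circ_pair_iff:
  fixes n p q :: int
  assumes pq: "1 \<le> p" "p < q" "2 * q < n"
  shows "singular_graph (Circ n {p, q}) \<longleftrightarrow>
    (\<exists>f::int \<Rightarrow> real. (\<exists>x. f x \<noteq> 0) \<and> (\<forall>x. f (x + n) = f x) \<and>
       (\<forall>x. f (x + p) + f (x - p) + f (x + q) + f (x - q) = 0))" (is "_ \<longleftrightarrow> ?R")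
proof -
  have verts: "pverts (Circ n {p, q}) = {0..<n}"
    by (simp add: Circ_def)
  have "singular_graph (Circ n {p, q}) \<longleftrightarrow>
    (\<exists>f::int \<Rightarrow> real. (\<exists>i\<in>{0..<n}. f i \<noteq> 0) \<and> (\<forall>i\<in>{0..<n}.
       f ((i + p) mod n) + f ((i - p) mod n) + f ((i + q) mod n) + f ((i - q) mod n) = 0))"
    (is "_ \<longleftrightarrow> ?M")
    using singular_graph_iff[of "Circ n {p, q}"] Circ_pair_neighbours_sum[OF pq]
    by (simp add: verts)
  also have "?M \<longleftrightarrow> ?R"
  proof
    assume ?M
    then obtain f :: "int \<Rightarrow> real" and i where f: "i \<in> {0..<n}" "f i \<noteq> 0"
      "\<And>i. i \<in> {0..<n} \<Longrightarrow>
        f ((i + p) mod n) + f ((i - p) mod n) + f ((i + q) mod n) + f ((i - q) mod n) = 0"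
      by blast
    \<comment> \<open>The periodic extension of \<open>f\<close> absorbs the reductions modulo
      \<open>n\<close> in the four arguments.\<close>
    let ?g = "\<lambda>x. f (x mod n)"
    have "?g (x + p) + ?g (x - p) + ?g (x + q) + ?g (x - q) = 0" for x
      using f(3)[of "x mod n"] pq by (simp add: mod_add_left_eq mod_diff_left_eq)
    moreover have "?g i \<noteq> 0"
      using f by simp
    moreover have "?g (x + n) = ?g x" for x
      by simp
    ultimately show ?R
      by (intro exI[of _ ?g]) blast
  next
    assume ?R
    then obtain f :: "int \<Rightarrow> real" and x where f: "f x \<noteq> 0" "\<And>x. f (x + n) = f x"
      "\<And>x. f (x + p) + f (x - p) + f (x + q) + f (x - q) = 0"
      by blast
    interpret periodic_fun_simple f n
      by standard (rule f)
    \<comment> \<open>Conversely, periodicity moves the nonzero value at \<open>x\<close> to its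
      representative in \<open>{0..<n}\<close>.\<close>
    have f_mod: "f (x mod n) = f x" for x
      using plus_of_int[of "x mod n" "x div n"] by simp
    have "x mod n \<in> {0..<n}" "f (x mod n) \<noteq> 0"
      using pq f(1) by (simp_all add: f_mod)
    then show ?M
      using f(3) by (intro exI[of _ f] conjI bexI[of _ "x mod n"])
        (simp_all add: f_mod)
  qed
  finally show ?thesis .
qed

section \<open>Antiperiodic functions and 2-adic valuations\<close>

lemma antiperiodic_eq_0:
  fixes f :: "int \<Rightarrow> real"
  assumes per: "\<And>x. f (x + n) = f x" and anti: "\<And>x. f (x + a) = - f x"
    and "n > 0" and le: "multiplicity 2 n \<le> multiplicity 2 a"
  shows "f x = 0"
proof -
  interpret periodic_fun_simple f n
    by standard (rule per)
  obtain m where n: "n = 2 ^ multiplicity 2 n * m" and "\<not> 2 dvd m"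
    using multiplicity_decompose'[of n 2] \<open>n > 0\<close> by auto
  have "2 ^ multiplicity 2 n dvd a"
    by (rule multiplicity_dvd'[OF le])
  then obtain b where a: "a = 2 ^ multiplicity 2 n * b"
    by blast
  have "m > 0"
    using n \<open>n > 0\<close> by (metis zero_less_mult_pos zero_less_numeral zero_less_power)
  then have "odd (nat m)"
    using \<open>\<not> 2 dvd m\<close> by (simp add: even_nat_iff)
  have iter: "f (x + of_nat k * a) = (-1) ^ k * f x" for k
  proof (induction k)
    case (Suc k)
    then show ?case
      using anti[of "x + of_nat k * a"] by (simp add: algebra_simps)
  qed simp
  \<comment> \<open>Both sides are \<open>2 ^ multiplicity 2 n * m * b\<close>. The same shift thus
    consists of \<open>b\<close> periods, which fix \<open>f\<close>, and of \<open>m\<close> sign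
    changes, an odd number.\<close>
  have "m * a = b * n"
    by (subst n, subst a) simp
  then have "f x = f (x + of_nat (nat m) * a)"
    using plus_of_int[of x b] \<open>m > 0\<close> by simp
  also have "\<dots> = - f x"
    using iter[of "nat m"] \<open>odd (nat m)\<close> by simp
  finally show ?thesis
    by simp
qed

text \<open>With \<open>s\<close> the valuation of \<open>a\<close>, the witness lives on the
  multiples of \<open>2 ^ s\<close> and alternates in sign along them: \<open>1\<close> at even
  multiples, \<open>-1\<close> at odd ones. Shifting by \<open>a\<close>, an odd multiple, flips the
  sign; shifting by \<open>n\<close>, an even multiple, preserves it.\<close>

lemma antiperiodic_exists:
  assumes "a \<noteq> 0" and less: "multiplicity 2 a < multiplicity 2 (n::int)"
  shows "\<exists>f::int \<Rightarrow> real. f 0 \<noteq> 0 \<and> (\<forall>x. f (x + n) = f x) \<and> (\<forall>x. f (x + a) = - f x)"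
proof -
  define s where "s = multiplicity 2 a"
  define f :: "int \<Rightarrow> real"
    where "f x = (if 2 ^ Suc s dvd x then 1 else if 2 ^ s dvd x then -1 else 0)" for x
  obtain c where a: "a = 2 ^ s * c" and "odd c"
    using multiplicity_decompose'[of a 2] \<open>a \<noteq> 0\<close> by (auto simp: s_def)
  have n: "2 ^ Suc s dvd n" "2 ^ s dvd n"
    using less multiplicity_dvd'[of "Suc s" 2 n] multiplicity_dvd'[of s 2 n] by (auto simp: s_def)
  have "f (x + a) = - f x" for x
  proof (cases "2 ^ s dvd x")
    case True
    then obtain y where x: "x = 2 ^ s * y"
      by blast
    have dvd: "2 ^ Suc s dvd 2 ^ s * z \<longleftrightarrow> even z" for z :: int
      by (simp add: mult.commute[of 2])
    have xa: "x + a = 2 ^ s * (y + c)"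
      by (simp add: x a algebra_simps)
    show ?thesis
      unfolding f_def xa unfolding x dvd using \<open>odd c\<close> by auto
  next
    case False
    then have no: "\<not> 2 ^ s dvd x + a"
      by (simp add: a dvd_add_left_iff)
    have "\<not> 2 ^ Suc s dvd z" if "\<not> 2 ^ s dvd z" for z :: int
      using that by (meson dvd_trans le_imp_power_dvd lessI less_imp_le)
    then show ?thesis
      using False no unfolding f_def by auto
  qed
  moreover have "f (x + n) = f x" for x
    using n unfolding f_def by (simp only: dvd_add_left_iff)
  moreover have "f 0 \<noteq> 0"
    by (simp add: f_def)
  ultimately show ?thesis
    by blast
qed

section \<open>Applying the factorisation of the shift operator\<close>

theorem corollary6:
  fixes n p q :: int
  assumes "n \<ge> 5" and "1 \<le> p" and "p < q" and "real_of_int q < real_of_int n / 2"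
  shows "singular_graph (Circ n {p, q}) \<longleftrightarrow>
    multiplicity 2 (p + q) < multiplicity 2 n \<or> multiplicity 2 (q - p) < multiplicity 2 n"
proof -
  have q: "2 * q < n"
    using assms(4) by linarith
  show ?thesis
    unfolding singular_Circ_pair_iff[OF assms(2,3) q]
  proof
    assume "\<exists>f::int \<Rightarrow> real. (\<exists>x. f x \<noteq> 0) \<and> (\<forall>x. f (x + n) = f x) \<and>
       (\<forall>x. f (x + p) + f (x - p) + f (x + q) + f (x - q) = 0)"
    then obtain f :: "int \<Rightarrow> real" and x where f: "f x \<noteq> 0" "\<And>x. f (x + n) = f x"
      "\<And>x. f (x + p) + f (x - p) + f (x + q) + f (x - q) = 0"
      by blast
    show "multiplicity 2 (p + q) < multiplicity 2 n \<or> multiplicity 2 (q - p) < multiplicity 2 n"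
    proof (rule ccontr)
      assume "\<not> ?thesis"
      then have le: "multiplicity 2 n \<le> multiplicity 2 (p + q)"
        "multiplicity 2 n \<le> multiplicity 2 (q - p)"
        by auto
      \<comment> \<open>This is the factor for \<open>q - p\<close> applied to \<open>f\<close>. The
        kernel equation at \<open>x + q\<close> says that \<open>g\<close> changes sign under
        \<open>p + q\<close>, so \<open>g\<close> vanishes; then \<open>f\<close> changes sign under
        \<open>q - p\<close> and vanishes as well.\<close>
      define g where "g x = f (x + (q - p)) + f x" for x
      have "n > 0"
        using assms(1) by simp
      have g_per: "g (x + n) = g x" for x
        using f(2)[of x] f(2)[of "x + (q - p)"] by (simp add: g_def algebra_simps)
      have g_anti: "g (x + (p + q)) = - g x" for x
        using f(3)[of "x + q"] by (simp add: g_def algebra_simps)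
      have "g x = 0" for x
        by (rule antiperiodic_eq_0[OF g_per g_anti \<open>n > 0\<close> le(1)])
      then have f_anti: "f (x + (q - p)) = - f x" for x
        by (simp add: g_def eq_neg_iff_add_eq_0)
      have "f x = 0"
        by (rule antiperiodic_eq_0[OF f(2) f_anti \<open>n > 0\<close> le(2)])
      with f(1) show False
        by contradiction
    qed
  next
    assume "multiplicity 2 (p + q) < multiplicity 2 n \<or> multiplicity 2 (q - p) < multiplicity 2 n"
    then obtain a where a: "a = p + q \<or> a = q - p" and less: "multiplicity 2 a < multiplicity 2 n"
      by blast
    obtain f :: "int \<Rightarrow> real" where f: "f 0 \<noteq> 0" "\<And>x. f (x + n) = f x" "\<And>x. f (x + a) = - f x"
      using antiperiodic_exists[OF _ less] a assms by auto
    \<comment> \<open>The four terms cancel in pairs that differ by a shift of \<open>a\<close>: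
      \<open>x - p\<close> with \<open>x + q\<close> and \<open>x - q\<close> with
      \<open>x + p\<close> if \<open>a = p + q\<close>, otherwise \<open>x + p\<close> with
      \<open>x + q\<close> and \<open>x - q\<close> with \<open>x - p\<close>.\<close>
    have "f (x + p) + f (x - p) + f (x + q) + f (x - q) = 0" for x
      using a
    proof
      assume "a = p + q"
      then show ?thesis
        using f(3)[of "x - p"] f(3)[of "x - q"] by (simp add: algebra_simps)
    next
      assume "a = q - p"
      then have *: "x + p + a = x + q" "x - q + a = x - p"
        by simp_all
      show ?thesis
        using f(3)[of "x + p"] f(3)[of "x - q"] unfolding * by simp
    qed
    then show "\<exists>f::int \<Rightarrow> real. (\<exists>x. f x \<noteq> 0) \<and> (\<forall>x. f (x + n) = f x) \<and>
       (\<forall>x. f (x + p) + f (x - p) + f (x + q) + f (x - q) = 0)"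
      using f by blast
  qed
qed

end
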